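(* Let $X$ be a normed linear space and let $I,K$ be ideals on $\mathbb{N}$. Suppose that for any sequence $\{x_n\}_{n\in\mathbb{N}}$ in $X$, weak $I$-convergence implies weak $I^K$-convergence (that is, whenever $\{x_n\}$ is weak $I$-convergent to $x\in X$, it is weak $I^K$-convergent to $x$). Then the condition AP$(I,K)$ holds.
   Context: $\mathbb{N}$ is the set of positive integers; $X$ is a (real or complex) normed linear space with dual $X^*$. An ideal on $\mathbb{N}$ is a class $I\subset 2^{\mathbb{N}}$ containing $\emptyset$ such that $A,B\in I$ implies $A\cup B\in I$, and $A\in I$, $B\subset A$ implies $B\in I$. Write $F(I)=\{A\subset\mathbb{N}:\mathbb{N}\setminus A\in I\}$. A sequence $\{x_n\}$ in $X$ is weak $I$-convergent to $x\in X$ if for every $\epsilon>0$ and every $f\in X^*$, $\{n\in\mathbb{N}:|f(x_n)-f(x)|\ge\epsilon\}\in I$. A sequence $\{x_n\}$ in $X$ is weak $I^K$-convergent to $x\in X$ if there exists $M\in F(I)$ such that the sequence $\{y_n\}$ defined by $y_n=x_n$ if $n\in M$ and $y_n=x$ if $n\notin M$ is weak $K$-convergent to $x$. For $A,B\subset\mathbb{N}$ write $A\subset_K B$ if $A\setminus B\in K$. The condition AP$(I,K)$ holds ($I$ has the additive property with respect to $K$) if for every sequence $(A_n)_{n\in\mathbb{N}}$ of sets from $I$ there is $A\in I$ such that $A_n\subset_K A$ for every $n$. Equivalent forms: every sequence $(F_n)_{n\in\mathbb{N}}$ of sets from $F(I)$ admits some $A\in F(I)$ with $A\subset_K F_n$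 for every $n$; or: for every sequence of mutually disjoint sets $(A_n)_{n\in\mathbb{N}}$ from $I$ there is a sequence $(B_n)_{n\in\mathbb{N}}$ of sets from $I$ with $A_n\bigtriangleup B_n\in K$ for every $n$ and $\bigcup_{n}B_n\in I$.
   Formalization: The normed linear space X is assumed to contain a nonzero vector; for X = {0} the claim fails, e.g. with I the finite sets, K = {∅} and A_n = {n}. *)

theory Defs
  imports Complex_Main
begin

text \<open>
  Scalar fields: the reals or the complex numbers. In the second alternative the norm is
  necessarily the usual absolute value, since norms in this class are multiplicative and
  extend that of the reals.
\<close>

class real_or_complex = real_normed_field +
  assumes real_or_complex:
    "(\<forall>z. \<exists>a. z = a *\<^sub>R 1) \<or>
     (\<exists>i. i * i = - 1 \<and> (\<forall>z. \<exists>a b. z = a *\<^sub>R 1 + b *\<^sub>R i))"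

instance real :: real_or_complex
  by standard auto

instance complex :: real_or_complex
proof (standard, rule disjI2, rule exI[of _ \<i>], intro conjI allI)
  fix z :: complex
  have "z = Re z *\<^sub>R 1 + Im z *\<^sub>R \<i>"
    by (simp add: complex_eq_iff)
  then show "\<exists>a b. z = a *\<^sub>R 1 + b *\<^sub>R \<i>"
    by blast
qed simp

text \<open>
  A normed space over the scalar field: the type class supplies the norm and the underlying
  real normed space, and the parameter is the scalar multiplication by the full field.
\<close>

locale normed_linear_space = vector_space scale
  for scale :: "'k::real_or_complex \<Rightarrow> 'a::real_normed_vector \<Rightarrow> 'a" +
  assumes scale_of_real: "scale (of_real r) x = r *\<^sub>R x"
    and norm_scale: "norm (scale c x) = norm c * norm x"

lemma normed_linear_space_scaleR:
  "normed_linear_space (scaleR :: real \<Rightarrow> 'a::real_normed_vector \<Rightarrow> 'a)"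
  by unfold_locales (simp_all add: algebra_simps)

lemma normed_linear_space_complex:
  "normed_linear_space ((*) :: complex \<Rightarrow> complex \<Rightarrow> complex)"
  by unfold_locales (simp_all add: algebra_simps norm_mult scaleR_conv_of_real)

definition dual_space ::
    "('k::real_or_complex \<Rightarrow> 'a::real_normed_vector \<Rightarrow> 'a) \<Rightarrow> ('a \<Rightarrow> 'k) set" where
  "dual_space scale =
     {f. Vector_Spaces.linear scale (*) f \<and> (\<exists>C. \<forall>x. norm (f x) \<le> C * norm x)}"

text \<open>
  Index sets are sets of positive integers. Sequences are functions on \<^typ>\<open>nat\<close> whose value
  at \<open>0\<close> is never inspected.
\<close>

abbreviation positives :: "nat set" where
  "positives \<equiv> {1..}"

definition ideal_on_positives :: "nat set set \<Rightarrow> bool" where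
  "ideal_on_positives I \<longleftrightarrow>
     I \<subseteq> Pow positives \<and> {} \<in> I \<and>
     (\<forall>A\<in>I. \<forall>B\<in>I. A \<union> B \<in> I) \<and>
     (\<forall>A\<in>I. \<forall>B. B \<subseteq> A \<longrightarrow> B \<in> I)"

definition dual_filter :: "nat set set \<Rightarrow> nat set set" where
  "dual_filter I = {A. A \<subseteq> positives \<and> positives - A \<in> I}"

definition weak_ideal_convergent ::
    "('k::real_or_complex \<Rightarrow> 'a::real_normed_vector \<Rightarrow> 'a) \<Rightarrow> nat set set \<Rightarrow>
     (nat \<Rightarrow> 'a) \<Rightarrow> 'a \<Rightarrow> bool" where
  "weak_ideal_convergent scale I xs x \<longleftrightarrow>
     (\<forall>\<epsilon>>0. \<forall>f\<in>dual_space scale.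
        {n \<in> positives. norm (f (xs n) - f x) \<ge> \<epsilon>} \<in> I)"

definition weak_IK_convergent ::
    "('k::real_or_complex \<Rightarrow> 'a::real_normed_vector \<Rightarrow> 'a) \<Rightarrow> nat set set \<Rightarrow> nat set set \<Rightarrow>
     (nat \<Rightarrow> 'a) \<Rightarrow> 'a \<Rightarrow> bool" where
  "weak_IK_convergent scale I K xs x \<longleftrightarrow>
     (\<exists>M\<in>dual_filter I.
        weak_ideal_convergent scale K (\<lambda>n. if n \<in> M then xs n else x) x)"

definition almost_subset :: "nat set set \<Rightarrow> nat set \<Rightarrow> nat set \<Rightarrow> bool" where
  "almost_subset K A B \<longleftrightarrow> A - B \<in> K"

definition additive_property :: "nat set set \<Rightarrow> nat set set \<Rightarrow> bool" where
  "additive_property I K \<longleftrightarrow>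
     (\<forall>A :: nat \<Rightarrow> nat set. (\<forall>n\<in>positives. A n \<in> I) \<longrightarrow>
        (\<exists>B\<in>I. \<forall>n\<in>positives. almost_subset K (A n) B))"

end

theory Submission imports Defs begin

text \<open>
  Given sets \<open>A\<^sub>1, A\<^sub>2, \<dots>\<close> in \<open>I\<close> and a vector \<open>v \<noteq> 0\<close>, put \<open>x\<^sub>n = v / k\<close> where \<open>k\<close> is the least
  index with \<open>n \<in> A\<^sub>k\<close>, and \<open>x\<^sub>n = 0\<close> if there is none. For a bounded functional \<open>f\<close> the set
  where \<open>\<bar>f x\<^sub>n\<bar> \<ge> \<epsilon>\<close> lies in finitely many \<open>A\<^sub>k\<close>, so the sequence is weakly \<open>I\<close>-convergent to
  \<open>0\<close>. If \<open>M\<close> witnesses weak \<open>I\<^sup>K\<close>-convergence, a functional with \<open>f v \<noteq> 0\<close> shows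
  \<open>A\<^sub>k \<inter> M \<in> K\<close>, so the complement of \<open>M\<close> is the required set.

  Such a functional exists because, by Zorn's lemma, there is a minimal sublinear function below
  any given one, and a minimal sublinear function is linear.
\<close>

section \<open>Sublinear functions and infima of chains\<close>

definition sublinear :: "('a::real_vector \<Rightarrow> real) \<Rightarrow> bool" where
  "sublinear q \<longleftrightarrow> (\<forall>x y. q (x + y) \<le> q x + q y) \<and> (\<forall>t\<ge>0. \<forall>x. q (t *\<^sub>R x) \<le> t * q x)"

lemma sublinearI:
  assumes "\<And>x y. q (x + y) \<le> q x + q y" "\<And>t x. t \<ge> 0 \<Longrightarrow> q (t *\<^sub>R x) \<le> t * q x"
  shows "sublinear q"
  using assms by (simp add: sublinear_def)

lemma sublinear_add: "sublinear q \<Longrightarrow> q (x + y) \<le> q x + q y"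
  by (simp add: sublinear_def)

lemma sublinear_scaleR_le: "sublinear q \<Longrightarrow> t \<ge> 0 \<Longrightarrow> q (t *\<^sub>R x) \<le> t * q x"
  by (simp add: sublinear_def)

lemma sublinear_zero: "sublinear q \<Longrightarrow> q 0 = 0"
  using sublinear_add[of q 0 0] sublinear_scaleR_le[of q 0 0] by simp

text \<open>For \<open>t > 0\<close> the missing inequality comes from applying the assumed one with
  factor \<open>1 / t\<close> to \<open>t *\<^sub>R x\<close>.\<close>

lemma sublinear_scaleR:
  assumes "sublinear q" "t \<ge> 0"
  shows "q (t *\<^sub>R x) = t * q x"
proof (cases "t = 0")
  case False
  then have "t > 0" using assms by simp
  have "q ((1 / t) *\<^sub>R (t *\<^sub>R x)) \<le> (1 / t) * q (t *\<^sub>R x)"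
    using assms by (intro sublinear_scaleR_le) auto
  then have "t * q x \<le> q (t *\<^sub>R x)"
    using \<open>t > 0\<close> by (simp add: field_simps)
  then show ?thesis
    using sublinear_scaleR_le[OF assms, of x] by simp
qed (simp add: assms sublinear_zero)

lemma sublinear_minus: "sublinear q \<Longrightarrow> - q (- x) \<le> q x"
  using sublinear_add[of q x "- x"] by (simp add: sublinear_zero)

lemma sublinear_norm: "sublinear (norm :: 'a::real_normed_vector \<Rightarrow> real)"
  by (intro sublinearI) (auto intro: norm_triangle_ineq)

text \<open>Supplies the bound of a chain in the Zorn argument. Subadditivity survives the infimum
  because, of two members \<open>r\<close> and \<open>s\<close>, the smaller one can be used at both
  \<open>x\<close> and \<open>y\<close>.\<close>

lemma sublinear_INF_chain:
  fixes C :: "('a::real_vector \<Rightarrow> real) set"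
  assumes "C \<noteq> {}" and sub: "\<And>q. q \<in> C \<Longrightarrow> sublinear q"
    and bdd: "\<And>x. bdd_below ((\<lambda>q. q x) ` C)"
    and chain: "\<And>q r. q \<in> C \<Longrightarrow> r \<in> C \<Longrightarrow> q \<le> r \<or> r \<le> q"
  shows "sublinear (\<lambda>x. INF q\<in>C. q x)"
proof (rule sublinearI)
  have low: "(INF q\<in>C. q x) \<le> r x" if "r \<in> C" for r x
    using bdd that by (rule cINF_lower)
  fix x y
  have "(INF q\<in>C. q (x + y)) \<le> r x + s y" if "r \<in> C" "s \<in> C" for r s
  proof (rule disjE[OF chain[OF that]])
    assume "r \<le> s"
    then show ?thesis
      using low[OF that(1), of "x + y"] sublinear_add[OF sub[OF that(1)], of x y]
      by (auto simp: le_fun_def intro: order_trans)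
  next
    assume "s \<le> r"
    then show ?thesis
      using low[OF that(2), of "x + y"] sublinear_add[OF sub[OF that(2)], of x y]
      by (auto simp: le_fun_def intro: order_trans)
  qed
  \<comment> \<open>The bound holds for \<open>r\<close> and \<open>s\<close> chosen independently,
    so the infimum is taken over \<open>s\<close> first and over \<open>r\<close>
    afterwards.\<close>
  then have "(INF q\<in>C. q (x + y)) - r x \<le> (INF s\<in>C. s y)" if "r \<in> C" for r
    using that by (intro cINF_greatest[OF \<open>C \<noteq> {}\<close>]) (force simp: diff_le_eq add.commute)
  then have "(INF q\<in>C. q (x + y)) - (INF s\<in>C. s y) \<le> (INF r\<in>C. r x)"
    by (intro cINF_greatest[OF \<open>C \<noteq> {}\<close>]) (simp add: algebra_simps)
  then show "(INF q\<in>C. q (x + y)) \<le> (INF q\<in>C. q x) + (INF q\<in>C. q y)"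
    by simp
next
  fix t :: real and x assume "t \<ge> 0"
  show "(INF q\<in>C. q (t *\<^sub>R x)) \<le> t * (INF q\<in>C. q x)"
  proof (cases "t = 0")
    case True
    then show ?thesis
      using \<open>C \<noteq> {}\<close> sub by (simp add: sublinear_zero)
  next
    case False
    with \<open>t \<ge> 0\<close> have "t > 0" by simp
    have "(INF q\<in>C. q (t *\<^sub>R x)) / t \<le> r x" if "r \<in> C" for r
      using cINF_lower[OF bdd that, of "t *\<^sub>R x"] \<open>t > 0\<close> sublinear_scaleR[OF sub[OF that], of t x]
      by (simp add: field_simps)
    then have "(INF q\<in>C. q (t *\<^sub>R x)) / t \<le> (INF q\<in>C. q x)"
      by (rule cINF_greatest[OF \<open>C \<noteq> {}\<close>])
    then show ?thesis
      using \<open>t > 0\<close> by (simp add: field_simps)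
  qed
qed

section \<open>Shifts, minimal sublinear functions and real functionals\<close>

text \<open>The largest sublinear function below \<open>q\<close> whose value at \<open>- y\<close> is \<open>- q y\<close>.\<close>

definition sublinear_shift :: "('a::real_vector \<Rightarrow> real) \<Rightarrow> 'a \<Rightarrow> 'a \<Rightarrow> real" where
  "sublinear_shift q y x = (INF t\<in>{0..}. q (x + t *\<^sub>R y) - t * q y)"

lemma sublinear_shift_le:
  assumes "sublinear q" "t \<ge> 0"
  shows "sublinear_shift q y x \<le> q (x + t *\<^sub>R y) - t * q y"
  unfolding sublinear_shift_def
proof (rule cINF_lower)
  \<comment> \<open>A lower bound independent of \<open>s\<close>, from \<open>s * q y = q (s
    *\<^sub>R y) \<le> q (x + s *\<^sub>R y) + q (- x)\<close>.\<close>
  have "- q (- x) \<le> q (x + s *\<^sub>R y) - s * q y" if "s \<ge> 0" for s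
    using sublinear_add[OF assms(1), of "x + s *\<^sub>R y" "- x"] sublinear_scaleR[OF assms(1) that, of y]
    by simp
  then show "bdd_below ((\<lambda>t. q (x + t *\<^sub>R y) - t * q y) ` {0..})"
    by (intro bdd_belowI2[where m = "- q (- x)"]) simp
qed (use assms in simp)

lemma sublinear_shift_greatest:
  assumes "\<And>t. t \<ge> 0 \<Longrightarrow> m \<le> q (x + t *\<^sub>R y) - t * q y"
  shows "m \<le> sublinear_shift q y x"
  unfolding sublinear_shift_def using assms by (intro cINF_greatest) auto

lemma sublinear_shift_le_self: "sublinear q \<Longrightarrow> sublinear_shift q y x \<le> q x"
  using sublinear_shift_le[of q 0 y x] by simp

text \<open>Parameters \<open>s\<close> for \<open>x\<close> and \<open>t\<close> for
  \<open>z\<close> combine to \<open>s + t\<close> for \<open>x + z\<close>, and a parameter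
  \<open>t\<close> for \<open>x\<close> becomes \<open>c * t\<close> for
  \<open>c *\<^sub>R x\<close>.\<close>

lemma sublinear_sublinear_shift:
  assumes "sublinear q"
  shows "sublinear (sublinear_shift q y)" (is "sublinear ?p")
proof (rule sublinearI)
  fix x z
  have "?p (x + z) \<le> (q (x + s *\<^sub>R y) - s * q y) + (q (z + t *\<^sub>R y) - t * q y)"
    if "s \<ge> 0" "t \<ge> 0" for s t
    using sublinear_shift_le[OF assms, of "s + t" y "x + z"] that
      sublinear_add[OF assms, of "x + s *\<^sub>R y" "z + t *\<^sub>R y"]
    by (simp add: algebra_simps)
  then have "?p (x + z) - (q (x + s *\<^sub>R y) - s * q y) \<le> ?p z" if "s \<ge> 0" for s
    using that by (intro sublinear_shift_greatest) (force simp: diff_le_eq add.commute)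
  then have "?p (x + z) - ?p z \<le> ?p x"
    by (intro sublinear_shift_greatest) (simp add: algebra_simps)
  then show "?p (x + z) \<le> ?p x + ?p z" by simp
next
  fix c :: real and x assume "c \<ge> 0"
  show "?p (c *\<^sub>R x) \<le> c * ?p x"
  proof (cases "c = 0")
    case True
    then show ?thesis
      using sublinear_shift_le_self[OF assms, of y 0] by (simp add: sublinear_zero assms)
  next
    case False
    with \<open>c \<ge> 0\<close> have "c > 0" by simp
    have "?p (c *\<^sub>R x) / c \<le> q (x + t *\<^sub>R y) - t * q y" if "t \<ge> 0" for t
      using sublinear_shift_le[OF assms, of "c * t" y "c *\<^sub>R x"] that \<open>c > 0\<close>
        sublinear_scaleR[OF assms \<open>c \<ge> 0\<close>, of "x + t *\<^sub>R y"]
      by (simp add: field_simps)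
    then have "?p (c *\<^sub>R x) / c \<le> ?p x"
      by (rule sublinear_shift_greatest)
    then show ?thesis
      using \<open>c > 0\<close> by (simp add: field_simps)
  qed
qed

text \<open>Minimality makes \<open>q\<close> equal to its own shift along every \<open>y\<close>.
  The parameter 1 then gives \<open>q x + q y \<le> q (x + y)\<close>, the reverse of subadditivity.
  Additivity makes \<open>q\<close> odd, which extends homogeneity to negative factors.\<close>

lemma minimal_sublinear_linear:
  assumes q: "sublinear q" and min: "\<And>r. sublinear r \<Longrightarrow> r \<le> q \<Longrightarrow> r = q"
  shows "linear q"
proof -
  have "sublinear_shift q y = q" for y
    by (intro min sublinear_sublinear_shift q le_funI sublinear_shift_le_self)
  then have add: "q (x + y) = q x + q y" for x y
    using sublinear_shift_le[OF q, of 1 y x] sublinear_add[OF q, of x y] by simp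
  have neg: "q (- x) = - q x" for x
    using add[of x "- x"] by (simp add: sublinear_zero q)
  have "q (c *\<^sub>R x) = c * q x" for c x
    using sublinear_scaleR[OF q, of c x] sublinear_scaleR[OF q, of "- c" x] neg[of "c *\<^sub>R x"]
    by (cases "c \<ge> 0") auto
  then show ?thesis
    by (intro linearI) (simp_all add: add)
qed

text \<open>The Hahn-Banach theorem in a form without a prescribed subspace.\<close>

lemma linear_below_sublinear:
  fixes p :: "'a::real_vector \<Rightarrow> real"
  assumes "sublinear p"
  obtains f where "linear f" "f \<le> p"
proof -
  define S where "S = {q. sublinear q \<and> q \<le> p}"
  have "\<exists>m\<in>S. \<forall>a\<in>S. m \<ge> a \<longrightarrow> a = m"
  \<comment> \<open>The order is reversed, so the maximal element from Zorn's lemma is a minimal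
    sublinear function.\<close>
  proof (rule predicate_Zorn)
    show "partial_order_on S (relation_of (\<ge>) S)"
      by (rule partial_order_on_relation_ofI) auto
  next
    fix C assume C: "C \<in> Chains (relation_of (\<ge>) S)"
    then have CS: "C \<subseteq> S"
      by (auto simp: Chains_def relation_of_def)
    have chain: "q \<le> r \<or> r \<le> q" if "q \<in> C" "r \<in> C" for q r
      using C that by (auto simp: Chains_def relation_of_def)
    show "\<exists>u\<in>S. \<forall>a\<in>C. a \<ge> u"
    proof (cases "C = {}")
      \<comment> \<open>The empty chain has no useful infimum; \<open>p\<close> itself serves as its
        bound.\<close>
      case True
      then show ?thesis using assms by (auto simp: S_def)
    next
      case False
      \<comment> \<open>Uniform over the chain:
        \<open>- p (- x) \<le> - q (- x) \<le> q x\<close>.\<close>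
      have bdd: "bdd_below ((\<lambda>q. q x) ` C)" for x
      proof (rule bdd_belowI2)
        fix q assume "q \<in> C"
        with CS have "sublinear q" "q (- x) \<le> p (- x)"
          by (auto simp: S_def le_fun_def)
        then show "- p (- x) \<le> q x"
          using sublinear_minus[of q x] by simp
      qed
      define u where "u = (\<lambda>x. INF q\<in>C. q x)"
      have low: "u \<le> q" if "q \<in> C" for q
        unfolding u_def using cINF_lower[OF bdd that] by (rule le_funI)
      have "sublinear u"
        unfolding u_def using CS by (intro sublinear_INF_chain False bdd chain) (auto simp: S_def)
      moreover have "u \<le> p"
        using False CS low by (force simp: S_def intro: order_trans)
      ultimately show ?thesis
        using low by (auto simp: S_def)
    qed
  qed
  then obtain m where "sublinear m" "m \<le> p" and min: "\<And>r. sublinear r \<Longrightarrow> r \<le> m \<Longrightarrow> r = m"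
    unfolding S_def by (auto intro: order_trans)
  then show thesis
    using that minimal_sublinear_linear by blast
qed

text \<open>Below the norm alone the zero functional would qualify. The shift of the norm along
  \<open>v\<close> is at most \<open>norm (- v + v) - norm v = - norm v\<close> at
  \<open>- v\<close>, which forces \<open>u v \<ge> norm v > 0\<close>.\<close>

lemma real_functional_nonzero:
  fixes v :: "'a::real_normed_vector"
  assumes "v \<noteq> 0"
  obtains u :: "'a \<Rightarrow> real" where "linear u" "\<And>x. \<bar>u x\<bar> \<le> norm x" "u v \<noteq> 0"
proof -
  obtain u where u: "linear u" "u \<le> sublinear_shift norm v"
    using linear_below_sublinear sublinear_sublinear_shift[OF sublinear_norm] by blast
  have le: "u x \<le> norm x" for x
    using u(2) sublinear_shift_le_self[OF sublinear_norm, of v x]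
    by (auto simp: le_fun_def intro: order_trans)
  have "\<bar>u x\<bar> \<le> norm x" for x
    using le[of x] le[of "- x"] linear_neg[OF u(1), of x] by simp
  moreover have "u (- v) \<le> - norm v"
    using u(2) sublinear_shift_le[OF sublinear_norm, of 1 v "- v"]
    by (auto simp: le_fun_def intro: order_trans)
  then have "u v \<noteq> 0"
    using assms linear_neg[OF u(1), of v] by auto
  ultimately show thesis
    using that u(1) by blast
qed

section \<open>Bounded functionals over real or complex scalars\<close>

context normed_linear_space
begin

lemma dual_space_scaleR:
  assumes "f \<in> dual_space scale"
  shows "f (r *\<^sub>R x) = of_real r * f x"
proof -
  interpret f: Vector_Spaces.linear scale "(*)" f
    using assms by (simp add: dual_space_def)
  show ?thesis
    using f.scale[of "of_real r" x] by (simp add: scale_of_real)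
qed

lemma dual_space_nonzero:
  assumes "v \<noteq> 0"
  obtains f where "f \<in> dual_space scale" "f v \<noteq> 0"
proof -
  obtain u where lin: "linear u" and bound: "\<And>x. \<bar>u x\<bar> \<le> norm x" and "u v \<noteq> 0"
    using real_functional_nonzero[OF assms] by blast
  have add: "u (x + y) = u x + u y" for x y
    using lin by (rule linear_add)
  have mult: "u (r *\<^sub>R x) = r * u x" for r x
    using linear_scale[OF lin] by simp
  have vs: "vector_space ((*) :: 'k \<Rightarrow> 'k \<Rightarrow> 'k)"
    by unfold_locales (simp_all add: algebra_simps)
  have dual: "f \<in> dual_space scale"
    if "\<And>x y. f (x + y) = f x + f y" "\<And>c x. f (scale c x) = c * f x"
      "\<And>x. norm (f x) \<le> C * norm x" for f C
    unfolding dual_space_def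
    using that vs vector_space_axioms by (auto simp: Vector_Spaces.linear_iff)
  consider "\<And>z::'k. \<exists>a. z = of_real a"
    | i :: 'k where "i * i = - 1" "\<And>z::'k. \<exists>a b. z = of_real a + of_real b * i"
    using real_or_complex[where 'a = 'k] by (auto simp: scaleR_conv_of_real)
  then show thesis
  proof cases
    case 1
    have "(\<lambda>x. of_real (u x)) \<in> dual_space scale"
    proof (rule dual[where C = 1])
      fix c :: 'k and x
      obtain a where "c = of_real a" using 1 by blast
      then show "of_real (u (scale c x)) = c * of_real (u x)"
        by (simp add: scale_of_real mult)
    qed (simp_all add: add bound)
    then show thesis
      using that \<open>u v \<noteq> 0\<close> by force
  next
    case 2
    txt \<open>A complex functional is recovered from its real part \<open>u\<close> as \<open>u x - i u (i x)\<close>.\<close>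
    define f where "f x = of_real (u x) - i * of_real (u (scale i x))" for x
    \<comment> \<open>The field is abstract, so \<open>norm i = 1\<close> has to be derived from
      \<open>i * i = - 1\<close> and multiplicativity of the norm.\<close>
    have "norm i * norm i = 1"
      using arg_cong[OF 2(1), of norm] by (simp add: norm_mult)
    then have ni: "norm i = 1"
      by (metis norm_ge_zero power2_eq_square power2_eq_1_iff abs_of_nonneg abs_minus_cancel
          abs_1)
    have "f \<in> dual_space scale"
    \<comment> \<open>The constant 2 comes from bounding \<open>u x\<close> and
      \<open>u (scale i x)\<close> separately by \<open>norm x\<close>.\<close>
    proof (rule dual[where C = 2])
      show "f (x + y) = f x + f y" for x y
        by (simp add: f_def add scale_right_distrib algebra_simps)
      show "norm (f x) \<le> 2 * norm x" for x
        using norm_triangle_ineq4[of "of_real (u x) :: 'k" "i * of_real (u (scale i x))"]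
          bound[of x] bound[of "scale i x"]
        by (simp add: f_def norm_mult ni norm_scale)
      show "f (scale c x) = c * f x" for c x
      proof -
        obtain a b where c: "c = of_real a + of_real b * i" using 2(2) by blast
        have re: "scale c x = a *\<^sub>R x + b *\<^sub>R scale i x"
          unfolding c by (simp add: scale_left_distrib scale_of_real flip: scale_scale)
        have "i * c = of_real a * i + of_real b * (i * i)"
          by (simp add: c algebra_simps)
        then have ic: "i * c = of_real a * i + of_real (- b)"
          by (simp add: 2(1))
        have im: "scale i (scale c x) = a *\<^sub>R scale i x + (- b) *\<^sub>R x"
          by (simp only: scale_scale ic scale_left_distrib flip: scale_of_real)
        have "f (scale c x) = of_real (a * u x + b * u (scale i x))
            - i * of_real (a * u (scale i x) + - b * u x)"
          unfolding f_def im unfolding re add mult ..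
        \<comment> \<open>Writing the sign of the term \<open>b * u (scale i x)\<close> as
          \<open>- (i * i)\<close> turns the comparison with \<open>c * f x\<close> into a pure ring
          identity.\<close>
        also have "\<dots> = of_real a * of_real (u x) - (i * i) * (of_real b * of_real (u (scale i x)))
            - i * (of_real a * of_real (u (scale i x)) - of_real b * of_real (u x))"
          by (simp add: 2(1))
        also have "\<dots> = c * f x"
          by (simp add: c f_def algebra_simps)
        finally show ?thesis .
      qed
    qed
    \<comment> \<open>Squaring \<open>u v = i * u (scale i v)\<close> gives a vanishing sum of two
      real squares, so no separation into real and imaginary parts is required.\<close>
    moreover have "f v \<noteq> 0"
    proof
      assume "f v = 0"
      then have "of_real (u v) = i * of_real (u (scale i v))"
        by (simp add: f_def)
      then have "of_real (u v) * of_real (u v) =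
          (i * i) * (of_real (u (scale i v)) * of_real (u (scale i v)))"
        by (simp add: algebra_simps)
      then have "of_real (u v * u v + u (scale i v) * u (scale i v)) = (0::'k)"
        by (simp add: 2(1))
      then show False
        using \<open>u v \<noteq> 0\<close> unfolding of_real_eq_0_iff sum_squares_eq_zero_iff by blast
    qed
    ultimately show thesis
      using that by blast
  qed
qed

end

section \<open>Ideals and the test sequence\<close>

lemma ideal_on_positives_subset: "ideal_on_positives I \<Longrightarrow> A \<in> I \<Longrightarrow> B \<subseteq> A \<Longrightarrow> B \<in> I"
  by (simp add: ideal_on_positives_def)

lemma ideal_on_positives_finite_UN:
  assumes "ideal_on_positives I" "finite S" "\<And>k. k \<in> S \<Longrightarrow> A k \<in> I"
  shows "(\<Union>k\<in>S. A k) \<in> I"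
  using assms(2,3)
  by (induction S) (use assms(1) in \<open>auto simp: ideal_on_positives_def\<close>)

theorem theorem3p5:
  fixes scale :: "'k::real_or_complex \<Rightarrow> 'a::real_normed_vector \<Rightarrow> 'a"
    and I K :: "nat set set"
  assumes "normed_linear_space scale"
    and "\<exists>x::'a. x \<noteq> 0"
    and "ideal_on_positives I"
    and "ideal_on_positives K"
    and "\<And>(xs :: nat \<Rightarrow> 'a) x. weak_ideal_convergent scale I xs x \<Longrightarrow>
           weak_IK_convergent scale I K xs x"
  shows "additive_property I K"
proof -
  interpret normed_linear_space scale by fact
  obtain v :: 'a where "v \<noteq> 0" using assms(2) by blast
  obtain g where g: "g \<in> dual_space scale" "g v \<noteq> 0"
    using dual_space_nonzero[OF \<open>v \<noteq> 0\<close>] .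
  have dual_zero: "f 0 = 0" if "f \<in> dual_space scale" for f
    using dual_space_scaleR[OF that, of 0 0] by simp
  show ?thesis
    unfolding additive_property_def
  proof (intro allI impI)
    fix A :: "nat \<Rightarrow> nat set"
    assume A: "\<forall>n\<in>positives. A n \<in> I"
    \<comment> \<open>Index 0 is excluded because \<open>A 0\<close> is arbitrary; this also keeps
      the divisor \<open>first n\<close> positive whenever \<open>n\<close> is hit.\<close>
    define hit where "hit n k \<longleftrightarrow> k \<ge> 1 \<and> n \<in> A k" for n k
    define first where "first n = (LEAST k. hit n k)" for n
    define xs where "xs n = (if Ex (hit n) then (1 / real (first n)) *\<^sub>R v else 0)" for n
    have first: "hit n (first n)" if "Ex (hit n)" for n
      unfolding first_def using that by (rule LeastI_ex)
    have norm_xs: "norm (f (xs n)) = norm (f v) / real (first n)"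
      if "f \<in> dual_space scale" "Ex (hit n)" for f n
      using that by (simp add: xs_def dual_space_scaleR norm_mult norm_divide)
    have "weak_ideal_convergent scale I xs 0"
      unfolding weak_ideal_convergent_def
    proof (intro allI impI ballI)
      fix \<epsilon> :: real and f assume "\<epsilon> > 0" and f: "f \<in> dual_space scale"
      \<comment> \<open>Chosen so that \<open>first n > N\<close> forces
        \<open>norm (f (xs n)) < \<epsilon>\<close>; only the first \<open>N\<close> sets can
        contribute.\<close>
      obtain N :: nat where N: "norm (f v) / \<epsilon> < real N"
        using reals_Archimedean2 by blast
      have "{n \<in> positives. norm (f (xs n) - f 0) \<ge> \<epsilon>} \<subseteq> (\<Union>k\<in>{1..N}. A k)"
      proof
        fix n assume "n \<in> {n \<in> positives. norm (f (xs n) - f 0) \<ge> \<epsilon>}"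
        then have n: "norm (f (xs n)) \<ge> \<epsilon>"
          using f by (simp add: dual_zero)
        then have ex: "Ex (hit n)"
          using f \<open>\<epsilon> > 0\<close> by (auto simp: xs_def dual_zero split: if_splits)
        then have "hit n (first n)" by (rule first)
        then have *: "first n \<ge> 1" "n \<in> A (first n)" by (auto simp: hit_def)
        have "real (first n) \<le> norm (f v) / \<epsilon>"
          using n * \<open>\<epsilon> > 0\<close> unfolding norm_xs[OF f ex] by (simp add: field_simps)
        with N have "first n \<le> N" by simp
        with * show "n \<in> (\<Union>k\<in>{1..N}. A k)" by auto
      qed
      moreover have "(\<Union>k\<in>{1..N}. A k) \<in> I"
        using A by (intro ideal_on_positives_finite_UN assms(3)) auto
      ultimately show "{n \<in> positives. norm (f (xs n) - f 0) \<ge> \<epsilon>} \<in> I"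
        using assms(3) ideal_on_positives_subset by blast
    qed
    then obtain M where M: "M \<in> dual_filter I"
      and conv: "weak_ideal_convergent scale K (\<lambda>n. if n \<in> M then xs n else 0) 0"
      using assms(5) unfolding weak_IK_convergent_def by blast
    \<comment> \<open>This difference is the intersection of \<open>A k\<close> with
      \<open>M\<close>. For \<open>n\<close> in it, \<open>first n \<le> k\<close>, so
      \<open>norm (g (xs n))\<close> is at least \<open>norm (g v) / real k\<close>, which explains
      the threshold \<open>?e\<close>.\<close>
    have "A k - (positives - M) \<in> K" if "k \<in> positives" for k
    proof -
      let ?e = "norm (g v) / real k"
      have "?e > 0" using g that by simp
      then have "{n \<in> positives. norm (g (if n \<in> M then xs n else 0) - g 0) \<ge> ?e} \<in> K"
        using conv g unfolding weak_ideal_convergent_def by blast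
      moreover have "A k - (positives - M)
          \<subseteq> {n \<in> positives. norm (g (if n \<in> M then xs n else 0) - g 0) \<ge> ?e}"
      proof
        fix n assume n: "n \<in> A k - (positives - M)"
        have "A k \<subseteq> positives"
          using A that assms(3) by (auto simp: ideal_on_positives_def)
        with n have "n \<in> positives" "n \<in> M" "hit n k"
          using that by (auto simp: hit_def)
        then have ex: "Ex (hit n)" and "first n \<le> k"
          unfolding first_def by (auto intro: Least_le)
        moreover have "first n \<ge> 1"
          using first[OF ex] by (simp add: hit_def)
        ultimately have "norm (g (xs n)) \<ge> ?e"
          unfolding norm_xs[OF g(1) ex] by (intro divide_left_mono) auto
        then show "n \<in> {n \<in> positives. norm (g (if n \<in> M then xs n else 0) - g 0) \<ge> ?e}"
          using \<open>n \<in> positives\<close> \<open>n \<in> M\<close> g(1) by (simp add: dual_zero)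
      qed
      ultimately show ?thesis
        using assms(4) ideal_on_positives_subset by blast
    qed
    moreover have "positives - M \<in> I"
      using M by (simp add: dual_filter_def)
    ultimately show "\<exists>B\<in>I. \<forall>n\<in>positives. almost_subset K (A n) B"
      unfolding almost_subset_def by blast
  qed
qed

end
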